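(* Let $(\lambda_2,\ldots,\lambda_n)$ be any list of complex numbers which is closed under complex conjugation, with $\lambda_2\ge\cdots\ge\lambda_p$ real, where $2\le p\le n$, and let $\lambda_{p+1},\ldots,\lambda_n$ be non-real, indexed so that $\lambda_{p+1},\ldots,\lambda_{\frac{n+p}{2}}$ contains exactly one member of each complex conjugate pair, with real and imaginary parts $x_i=\Re(\lambda_i)$ and $y_i=\Im(\lambda_i)$ for $i=p+1,\ldots,\frac{n+p}{2}$. Let $$w=\min\{\pm\lambda_2,\ldots,\pm\lambda_p,\ \pm x_{p+1},\pm y_{p+1},\ldots,\pm x_{\frac{n+p}{2}},\pm y_{\frac{n+p}{2}}\}.$$ Then there exists a least real number $\lambda_0$ with $$\max_{2\le j\le n}|\lambda_j|\le\lambda_0\le (n-1)|w|$$ such that the list of complex numbers $(\lambda_1;\lambda_2,\ldots,\lambda_n)$ is realizable if and only if $\lambda_1\ge\lambda_0$.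
   Context: Lists are considered with multiplicity. A list $(\lambda_1;\lambda_2,\ldots,\lambda_n)$, with a semicolon after the first entry, is realizable if it is the spectrum (list of eigenvalues counted with multiplicity) of an $n\times n$ matrix with real nonnegative entries whose Perron eigenvalue (the nonnegative eigenvalue that is at least the modulus of every other eigenvalue) is $\lambda_1$. The notation $\min\{\pm a,\pm b,\ldots\}$ means the minimum of the set containing $a,-a,b,-b,\ldots$. *)

theory Defs
  imports "Jordan_Normal_Form.Char_Poly" "HOL-Library.Multiset"
begin

text \<open>A finite list of complex numbers is the spectrum of a square matrix, counted with (algebraic)
  multiplicity, if the characteristic polynomial is the product of the corresponding monic
  linear factors. The order of the list is irrelevant.\<close>

definition has_spectrum :: "real mat \<Rightarrow> complex list \<Rightarrow> bool" where
  "has_spectrum A es \<longleftrightarrow>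
     char_poly (map_mat complex_of_real A) = (\<Prod>e\<leftarrow>es. [:- e, 1:])"

text \<open>\<open>realizable r es\<close> is realizability of the list \<open>(r; es)\<close>. The distinguished entry \<open>r\<close> is real
  because a Perron eigenvalue is a nonnegative real number; the last two conjuncts say that it is
  the Perron eigenvalue of the realizing matrix.\<close>

definition realizable :: "real \<Rightarrow> complex list \<Rightarrow> bool" where
  "realizable r es \<longleftrightarrow>
     (\<exists>A \<in> carrier_mat (Suc (length es)) (Suc (length es)).
        (\<forall>i < Suc (length es). \<forall>j < Suc (length es). 0 \<le> A $$ (i, j)) \<and>
        has_spectrum A (complex_of_real r # es) \<and>
        0 \<le> r \<and> (\<forall>z \<in> set es. cmod z \<le> r))"

end

theory Submission
  imports Defs
begin

text \<open>Every realizable list \<open>(r; es)\<close> is the spectrum of a nonnegative matrix all of whose row sums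
  are \<open>r\<close>: perturb a realizing matrix to a positive one, conjugate it by the diagonal matrix of
  its Perron vector, and let the perturbation tend to 0; the entries stay bounded because the row
  sums do. For a matrix \<open>A\<close> with constant row sums \<open>r\<close> the characteristic polynomial is \<open>X - r\<close>
  times that of a smaller matrix which does not change when one and the same row vector \<open>q\<close> is
  added to all rows, so that \<open>A + e q\<^sup>T\<close> differs from \<open>A\<close> in the eigenvalue \<open>r\<close> only (Brauer).
  Hence the realizable Perron values form an upward closed set, which is topologically closed by
  compactness, and \<open>\<lambda>\<^sub>0\<close> is its minimum. For the upper bound, start from a 2 by 2 matrix with
  spectrum \<open>(|w|; \<lambda>\<^sub>2)\<close> and adjoin the other real numbers and conjugate pairs one after the other
  as diagonal blocks, filling up the new rows to constant row sums and then adding a row \<open>q\<close>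
  that makes everything nonnegative. An adjoined block of size \<open>k\<close> costs \<open>k |w|\<close>.\<close>

section \<open>Limits of nonnegative matrices with constant row sums\<close>

text \<open>Bolzano-Weierstrass, one coordinate at a time: each new coordinate is handled by a
  monotone, bounded subsequence of the one already chosen. An arbitrary finite index set covers both
  matrices and vectors.\<close>

lemma finite_index_convergent_subseq:
  fixes f :: "nat \<Rightarrow> 'i \<Rightarrow> real"
  assumes "finite I" "\<And>k i. i \<in> I \<Longrightarrow> \<bar>f k i\<bar> \<le> M"
  shows "\<exists>\<phi> g. strict_mono \<phi> \<and> (\<forall>i\<in>I. (\<lambda>k. f (\<phi> k) i) \<longlonglongrightarrow> g i)"
  using assms
proof (induction I)
  case empty
  then show ?case using strict_mono_id by auto
next
  case (insert a I)
  then obtain \<phi> g where \<phi>: "strict_mono (\<phi> :: nat \<Rightarrow> nat)" "\<forall>i\<in>I. (\<lambda>k. f (\<phi> k) i) \<longlonglongrightarrow> g i"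
    by auto
  obtain \<psi> where \<psi>: "strict_mono (\<psi> :: nat \<Rightarrow> nat)" "monoseq (\<lambda>k. f (\<phi> (\<psi> k)) a)"
    using seq_monosub[of "\<lambda>k. f (\<phi> k) a"] by auto
  have "Bseq (\<lambda>k. f (\<phi> (\<psi> k)) a)"
    by (rule BseqI'[of _ M]) (use insert.prems in auto)
  then obtain c where c: "(\<lambda>k. f (\<phi> (\<psi> k)) a) \<longlonglongrightarrow> c"
    using Bseq_monoseq_convergent \<psi>(2) unfolding convergent_def by blast
  have "(\<lambda>k. f (\<phi> (\<psi> k)) i) \<longlonglongrightarrow> (g(a := c)) i" if "i \<in> insert a I" for i
    using that c LIMSEQ_subseq_LIMSEQ[OF bspec[OF \<phi>(2)] \<psi>(1)] insert.hyps
    by (auto simp: o_def)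
  moreover have "strict_mono (\<lambda>k. \<phi> (\<psi> k))"
    using \<phi>(1) \<psi>(1) by (simp add: strict_mono_def)
  ultimately show ?case by blast
qed

section \<open>Continuity of the determinant and the characteristic polynomial in the
  entries\<close>

lemma tendsto_det:
  fixes A :: "'b \<Rightarrow> 'a :: real_normed_field mat"
  assumes "\<And>k. A k \<in> carrier_mat n n" "B \<in> carrier_mat n n"
    and "\<And>i j. i < n \<Longrightarrow> j < n \<Longrightarrow> ((\<lambda>k. A k $$ (i, j)) \<longlongrightarrow> B $$ (i, j)) F"
  shows "((\<lambda>k. det (A k)) \<longlongrightarrow> det B) F"
  unfolding det_def'[OF assms(1)] det_def'[OF assms(2)]
  by (intro tendsto_sum tendsto_mult tendsto_const tendsto_prod assms(3))
     (auto dest: permutes_in_image)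

lemma tendsto_char_poly:
  fixes A :: "'b \<Rightarrow> 'a :: real_normed_field mat"
  assumes "\<And>k. A k \<in> carrier_mat n n" "B \<in> carrier_mat n n"
    and "\<And>i j. i < n \<Longrightarrow> j < n \<Longrightarrow> ((\<lambda>k. A k $$ (i, j)) \<longlongrightarrow> B $$ (i, j)) F"
  shows "((\<lambda>k. poly (char_poly (A k)) z) \<longlongrightarrow> poly (char_poly B) z) F"
  unfolding char_poly_matrix[OF assms(1)] char_poly_matrix[OF assms(2)]
proof (rule tendsto_det[of _ n])
  fix i j assume ij: "i < n" "j < n"
  have "(- char_matrix X z) $$ (i, j) = - (X $$ (i, j) - z * (if i = j then 1 else 0))"
    if "X \<in> carrier_mat n n" for X
    using that ij by (auto simp: char_matrix_def)
  then show "((\<lambda>k. (- char_matrix (A k) z) $$ (i, j)) \<longlongrightarrow> (- char_matrix B z) $$ (i, j)) F"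
    using assms ij by (auto intro!: tendsto_intros)
qed (use assms in auto)

text \<open>For \<open>r > 0\<close> these are the \<open>r\<close>-fold multiples of row stochastic
  matrices: the all-ones vector is a Perron vector with value \<open>r\<close>.\<close>

definition nonneg_row_sum_mat :: "nat \<Rightarrow> real \<Rightarrow> real mat \<Rightarrow> bool" where
  "nonneg_row_sum_mat n r A \<longleftrightarrow> A \<in> carrier_mat n n \<and>
     (\<forall>i<n. \<forall>j<n. 0 \<le> A $$ (i, j)) \<and> (\<forall>i<n. (\<Sum>j=0..<n. A $$ (i, j)) = r)"

abbreviation char_poly_c :: "real mat \<Rightarrow> complex poly" where
  "char_poly_c A \<equiv> char_poly (map_mat complex_of_real A)"

lemma nonneg_row_sum_mat_entry_le:
  assumes "nonneg_row_sum_mat n r A" "i < n" "j < n"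
  shows "\<bar>A $$ (i, j)\<bar> \<le> r"
  using assms member_le_sum[of j "{0..<n}" "\<lambda>j. A $$ (i, j)"]
  by (force simp: nonneg_row_sum_mat_def)

text \<open>Compactness: bounded row sums bound the entries, so a subsequence converges entrywise,
  and all conditions are closed. Convergence of \<open>r\<close> itself is not assumed.\<close>

lemma nonneg_row_sum_mat_limit:
  assumes "n > 0" and A: "\<And>k. nonneg_row_sum_mat n (r k) (A k)"
    and M: "\<And>k. r k \<le> M"
    and P: "\<And>z. (\<lambda>k. poly (char_poly_c (A k)) z) \<longlonglongrightarrow> poly P z"
  shows "\<exists>s B. nonneg_row_sum_mat n s B \<and> char_poly_c B = P"
proof -
  have c: "A k \<in> carrier_mat n n" for k
    using A by (simp add: nonneg_row_sum_mat_def)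
  let ?I = "{0..<n} \<times> {0..<n}"
  have bd: "\<bar>A k $$ ij\<bar> \<le> M" if "ij \<in> ?I" for k ij
    using that nonneg_row_sum_mat_entry_le[OF A, of "fst ij" "snd ij" k] M[of k] by (cases ij) auto
  obtain \<phi> g where \<phi>: "strict_mono (\<phi> :: nat \<Rightarrow> nat)"
    and g: "\<forall>ij\<in>?I. (\<lambda>k. A (\<phi> k) $$ ij) \<longlonglongrightarrow> g ij"
    using finite_index_convergent_subseq[of ?I "\<lambda>k ij. A k $$ ij" M] bd by auto
  define B where "B = mat n n g"
  have B: "B \<in> carrier_mat n n" by (simp add: B_def)
  have lim: "(\<lambda>k. A (\<phi> k) $$ (i, j)) \<longlonglongrightarrow> B $$ (i, j)" if "i < n" "j < n" for i j
    using g that by (simp add: B_def)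
  have rs: "(\<lambda>k. r (\<phi> k)) \<longlonglongrightarrow> (\<Sum>j=0..<n. B $$ (i, j))" if "i < n" for i
  proof -
    have "(\<lambda>k. \<Sum>j=0..<n. A (\<phi> k) $$ (i, j)) \<longlonglongrightarrow> (\<Sum>j=0..<n. B $$ (i, j))"
      using that by (intro tendsto_sum lim) auto
    then show ?thesis using A that by (simp add: nonneg_row_sum_mat_def)
  qed
  have "0 \<le> B $$ (i, j)" if "i < n" "j < n" for i j
    by (rule LIMSEQ_le_const[OF lim[OF that]]) (use A that in \<open>auto simp: nonneg_row_sum_mat_def\<close>)
  \<comment> \<open>Every row sum of \<open>B\<close> is a limit of the same sequence
    \<open>r (\<phi> k)\<close>.\<close>
  moreover have "(\<Sum>j=0..<n. B $$ (i, j)) = (\<Sum>j=0..<n. B $$ (0, j))" if "i < n" for i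
    by (rule LIMSEQ_unique[OF rs[OF that] rs[OF \<open>n > 0\<close>]])
  ultimately have "nonneg_row_sum_mat n (\<Sum>j=0..<n. B $$ (0, j)) B"
    using B unfolding nonneg_row_sum_mat_def by blast
  \<comment> \<open>Complex polynomials are determined by their values, so pointwise limits
    suffice.\<close>
  moreover have "poly (char_poly_c B) = poly P"
  proof
    fix z :: complex
    have "(\<lambda>k. poly (char_poly_c (A (\<phi> k))) z) \<longlonglongrightarrow> poly (char_poly_c B) z"
    proof (rule tendsto_char_poly[of _ n])
      fix i j assume "i < n" "j < n"
      then show "(\<lambda>k. map_mat complex_of_real (A (\<phi> k)) $$ (i, j))
        \<longlonglongrightarrow> map_mat complex_of_real B $$ (i, j)"
        using tendsto_of_real[OF lim, of i j] c B carrier_matD[OF c] by simp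
    qed (use c B in auto)
    moreover have "(\<lambda>k. poly (char_poly_c (A (\<phi> k))) z) \<longlonglongrightarrow> poly P z"
      using LIMSEQ_subseq_LIMSEQ[OF P \<phi>] by (simp add: o_def)
    ultimately show "poly (char_poly_c B) z = poly P z" by (rule LIMSEQ_unique)
  qed
  ultimately show ?thesis unfolding poly_eq_poly_eq_iff by blast
qed

text \<open>Compare both sides of the eigenvector equation in a coordinate where the eigenvector has
  maximal modulus.\<close>

lemma nonneg_row_sum_mat_root_le:
  assumes "nonneg_row_sum_mat n r A" "poly (char_poly_c A) z = 0"
  shows "cmod z \<le> r"
proof -
  let ?A = "map_mat complex_of_real A"
  have A: "A \<in> carrier_mat n n" using assms(1) by (simp add: nonneg_row_sum_mat_def)
  then have cA: "?A \<in> carrier_mat n n" by simp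
  obtain v where v: "v \<in> carrier_vec n" "v \<noteq> 0\<^sub>v n" "?A *\<^sub>v v = z \<cdot>\<^sub>v v"
    using assms(2) A unfolding eigenvalue_root_char_poly[OF cA, symmetric]
    by (auto simp: eigenvalue_def eigenvector_def)
  obtain l where l: "l < n" "v $ l \<noteq> 0"
    using v(1,2) by (metis carrier_vecD eq_vecI index_zero_vec)
  obtain i where i: "i < n" "\<And>j. j < n \<Longrightarrow> cmod (v $ j) \<le> cmod (v $ i)"
  proof (rule obtains_MAX[of "{0..<n}" "\<lambda>i. cmod (v $ i)"])
    fix i assume "i \<in> {0..<n}" "Max ((\<lambda>i. cmod (v $ i)) ` {0..<n}) = cmod (v $ i)"
    then show thesis
      by (intro that[of i]) (auto intro!: Max_ge simp flip: \<open>Max _ = _\<close>)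
  qed (use l in auto)
  have pos: "cmod (v $ i) > 0" using i(2)[OF l(1)] l(2) by (metis less_le_trans zero_less_norm_iff)
  have "z * v $ i = (\<Sum>j=0..<n. complex_of_real (A $$ (i, j)) * v $ j)"
    using arg_cong[OF v(3), of "\<lambda>u. u $ i"] i(1) v(1) A by (simp add: scalar_prod_def)
  then have "cmod z * cmod (v $ i) = cmod (\<Sum>j=0..<n. complex_of_real (A $$ (i, j)) * v $ j)"
    by (metis norm_mult)
  also have "\<dots> \<le> (\<Sum>j=0..<n. A $$ (i, j) * cmod (v $ i))"
    using assms(1) i
    by (intro sum_norm_le) (auto simp: norm_mult nonneg_row_sum_mat_def intro!: mult_mono)
  also have "\<dots> = r * cmod (v $ i)"
    using assms(1) i(1) by (simp add: nonneg_row_sum_mat_def flip: sum_distrib_right)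
  finally show ?thesis using pos by simp
qed

section \<open>Deflation by the constant vector\<close>

text \<open>For constant row sums this is the map induced on the quotient by the all-ones vector, in
  the classes of the unit vectors other than the first.\<close>

definition deflate :: "'a :: ring_1 mat \<Rightarrow> 'a mat" where
  "deflate A = mat (dim_row A - 1) (dim_col A - 1)
     (\<lambda>(i, j). A $$ (Suc i, Suc j) - A $$ (0, Suc j))"

text \<open>In a basis whose first member is the all-ones vector, an eigenvector for
  \<open>r\<close>, the matrix becomes block upper triangular.\<close>

lemma char_poly_deflate:
  fixes A :: "'a :: idom mat"
  assumes A: "A \<in> carrier_mat (Suc n) (Suc n)"
    and r: "\<And>i. i < Suc n \<Longrightarrow> (\<Sum>j=0..<Suc n. A $$ (i, j)) = r"
  shows "char_poly A = [:- r, 1:] * char_poly (deflate A)"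
proof -
  \<comment> \<open>\<open>S\<close> is the change of basis replacing the first unit vector by the
    all-ones vector, and \<open>Q\<close> is its inverse.\<close>
  define S where "S = mat (Suc n) (Suc n) (\<lambda>(i, j). if j = 0 \<or> i = j then 1 else 0 :: 'a)"
  define Q where "Q = mat (Suc n) (Suc n)
    (\<lambda>(i, j). if i = j then 1 else if j = 0 then - 1 else 0 :: 'a)"
  define R where "R = mat 1 1 (\<lambda>_. r)"
  define U where "U = mat 1 n (\<lambda>(i, j). A $$ (0, Suc j))"
  define T where "T = four_block_mat R U (0\<^sub>m n 1) (deflate A)"
  have D: "deflate A \<in> carrier_mat n n" using A by (auto simp: deflate_def)
  have carr: "S \<in> carrier_mat (Suc n) (Suc n)" "Q \<in> carrier_mat (Suc n) (Suc n)"
    "R \<in> carrier_mat 1 1" "U \<in> carrier_mat 1 n"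
    by (simp_all add: S_def Q_def R_def U_def)
  then have T: "T \<in> carrier_mat (Suc n) (Suc n)"
    using D unfolding T_def by (metis four_block_carrier_mat plus_1_eq_Suc)
  have row_S: "(S * X) $$ (i, j) = (if i = 0 then X $$ (0, j) else X $$ (0, j) + X $$ (i, j))"
    if "X \<in> carrier_mat (Suc n) (Suc n)" "i < Suc n" "j < Suc n" for X i j
  proof -
    have "(S * X) $$ (i, j) = (\<Sum>k=0..<Suc n. (if k = 0 \<or> i = k then 1 else 0) * X $$ (k, j))"
      using that by (simp add: S_def scalar_prod_def del: sum.op_ivl_Suc)
    also have "\<dots> = X $$ (0, j) + (\<Sum>k=Suc 0..<Suc n. (if k = 0 \<or> i = k then 1 else 0) * X $$ (k, j))"
      by (subst sum.atLeast_Suc_lessThan) simp_all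
    also have "(\<Sum>k=Suc 0..<Suc n. (if k = 0 \<or> i = k then 1 else 0) * X $$ (k, j))
      = (\<Sum>k=Suc 0..<Suc n. if k = i then X $$ (k, j) else 0)"
      by (intro sum.cong) auto
    finally show ?thesis using that by (simp add: sum.delta del: sum.op_ivl_Suc)
  qed
  have col_S: "(X * S) $$ (i, j) = (if j = 0 then (\<Sum>k=0..<Suc n. X $$ (i, k)) else X $$ (i, j))"
    if "X \<in> carrier_mat (Suc n) (Suc n)" "i < Suc n" "j < Suc n" for X i j
  proof -
    have "(X * S) $$ (i, j) = (\<Sum>k=0..<Suc n. if j = 0 \<or> k = j then X $$ (i, k) else 0)"
      using that by (auto simp add: S_def scalar_prod_def simp del: sum.op_ivl_Suc intro!: sum.cong)
    also have "\<dots> = (if j = 0 then (\<Sum>k=0..<Suc n. X $$ (i, k)) else X $$ (i, j))"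
      using that by (simp add: sum.delta del: sum.op_ivl_Suc)
    finally show ?thesis .
  qed
  have SQ: "S * Q = 1\<^sub>m (Suc n)"
  proof (rule eq_matI)
    fix i j assume "i < dim_row (1\<^sub>m (Suc n) :: 'a mat)" "j < dim_col (1\<^sub>m (Suc n) :: 'a mat)"
    then show "(S * Q) $$ (i, j) = 1\<^sub>m (Suc n) $$ (i, j)"
      using row_S[OF carr(2), of i j] by (auto simp: Q_def)
  qed (simp_all add: S_def Q_def)
  have AS: "A * S = S * T"
  proof (rule eq_matI)
    fix i j assume "i < dim_row (S * T)" "j < dim_col (S * T)"
    then have ij: "i < Suc n" "j < Suc n" using carr T by auto
    show "(A * S) $$ (i, j) = (S * T) $$ (i, j)"
      unfolding row_S[OF T ij] col_S[OF A ij]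
      using ij A r[OF ij(1)]
      by (auto simp: T_def R_def U_def deflate_def index_mat_four_block simp del: sum.op_ivl_Suc)
  qed (use A T carr in auto)
  have QS: "Q * S = 1\<^sub>m (Suc n)"
  proof (rule eq_matI)
    fix i j assume "i < dim_row (1\<^sub>m (Suc n) :: 'a mat)" "j < dim_col (1\<^sub>m (Suc n) :: 'a mat)"
    then have ij: "i < Suc n" "j < Suc n" by auto
    have "(\<Sum>k=0..<Suc n. Q $$ (i, k)) = (if i = 0 then 1 else 0)"
    proof -
      have "(\<Sum>k=0..<Suc n. Q $$ (i, k))
        = (\<Sum>k=0..<Suc n. (if k = i then 1 else 0) - (if k = 0 \<and> i \<noteq> 0 then 1 else 0))"
        using ij by (intro sum.cong) (auto simp: Q_def)
      also have "\<dots> = (if i = 0 then 1 else 0)"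
        using ij by (cases "i = 0") (simp_all add: sum_subtractf del: sum.op_ivl_Suc)
      finally show ?thesis .
    qed
    then show "(Q * S) $$ (i, j) = 1\<^sub>m (Suc n) $$ (i, j)"
      unfolding col_S[OF carr(2) ij] using ij by (auto simp: Q_def simp del: sum.op_ivl_Suc)
  qed (simp_all add: S_def Q_def)
  have "S * T * Q = A * (S * Q)"
    using A T carr AS by (metis assoc_mult_mat)
  then have "A = S * T * Q" using A SQ by simp
  then have "similar_mat A T"
    using SQ QS A T carr by (intro similar_matI[of _ _ S Q "Suc n"]) auto
  then have "char_poly A = char_poly R * char_poly (deflate A)"
    using char_poly_similar char_poly_four_block_zeros_col[OF carr(3,4) D] unfolding T_def by metis
  moreover have "char_poly R = [:- r, 1:]"
    by (simp add: char_poly_defs R_def det_single)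
  ultimately show ?thesis by simp
qed

section \<open>Perron vectors\<close>

text \<open>The maximal \<open>t\<close> with \<open>t v \<le> a v\<close> for some nonzero \<open>v \<ge> 0\<close> is attained. Equality holds there,
  since otherwise \<open>a v\<close> would satisfy the inequality strictly and allow a larger \<open>t\<close>.\<close>

lemma perron_vector:
  fixes a :: "nat \<Rightarrow> nat \<Rightarrow> real"
  assumes n: "n > 0" and pos: "\<And>i j. i < n \<Longrightarrow> j < n \<Longrightarrow> 0 < a i j"
  shows "\<exists>v t. (\<forall>i<n. 0 < v i) \<and> (\<forall>i<n. (\<Sum>j=0..<n. a i j * v j) = t * v i)"
proof -
  \<comment> \<open>The normalization to sum 1 keeps admissible vectors bounded and their limits
    nonzero.\<close>
  define sub where "sub t v \<longleftrightarrow> (\<forall>i<n. 0 \<le> v i) \<and> (\<Sum>i=0..<n. v i) = 1 \<and>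
    (\<forall>i<n. t * v i \<le> (\<Sum>j=0..<n. a i j * v j))" for t :: real and v :: "nat \<Rightarrow> real"
  have le1: "v i \<le> 1" if "sub t v" "i < n" for t v i
    using member_le_sum[of i "{0..<n}" v] that by (auto simp: sub_def)
  define T where "T = {t. \<exists>v. sub t v}"
  have bound: "t \<le> (\<Sum>i=0..<n. \<Sum>j=0..<n. a i j)" if "t \<in> T" for t
  proof -
    obtain v where v: "sub t v" using \<open>t \<in> T\<close> by (auto simp: T_def)
    have "t = (\<Sum>i=0..<n. t * v i)" using v by (simp add: sub_def flip: sum_distrib_left)
    also have "\<dots> \<le> (\<Sum>i=0..<n. \<Sum>j=0..<n. a i j * v j)"
      using v by (intro sum_mono) (auto simp: sub_def)
    also have "\<dots> \<le> (\<Sum>i=0..<n. \<Sum>j=0..<n. a i j)"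
    proof (intro sum_mono)
      fix i j assume "i \<in> {0..<n}" "j \<in> {0..<n}"
      then show "a i j * v j \<le> a i j"
        using le1[OF v, of j] pos[of i j] by (simp add: mult_left_le)
    qed
    finally show ?thesis .
  qed
  have "sub 0 (\<lambda>i. if i = 0 then 1 else 0)"
    using n pos by (auto simp: sub_def less_imp_le intro!: sum_nonneg)
  then have ne: "T \<noteq> {}" by (auto simp: T_def)
  have bdd: "bdd_above T" by (rule bdd_aboveI) (rule bound)
  define t where "t = Sup T"
  \<comment> \<open>A vector admissible for some \<open>s\<close> is admissible for every smaller
    value, because its entries are nonnegative.\<close>
  have "\<exists>v. sub (t - 1 / real (Suc k)) v" for k
  proof -
    have "t - 1 / real (Suc k) < Sup T" by (simp add: t_def)
    then obtain s where s: "s \<in> T" "t - 1 / real (Suc k) < s"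
      using less_cSupD[OF ne] by blast
    then obtain v where v: "sub s v" by (auto simp: T_def)
    have "(t - 1 / real (Suc k)) * v i \<le> s * v i" if "i < n" for i
      using s(2) v that by (intro mult_right_mono) (auto simp: sub_def)
    then have "sub (t - 1 / real (Suc k)) v"
      using v unfolding sub_def by (meson order_trans)
    then show ?thesis by blast
  qed
  then obtain V where V: "\<And>k. sub (t - 1 / real (Suc k)) (V k)" by metis
  have Vb: "\<bar>V k i\<bar> \<le> 1" if "i \<in> {0..<n}" for k i
    using le1[OF V, of i k] V[of k] that by (simp add: sub_def)
  obtain \<phi> v where \<phi>: "strict_mono (\<phi> :: nat \<Rightarrow> nat)"
    and v: "\<forall>i\<in>{0..<n}. (\<lambda>k. V (\<phi> k) i) \<longlonglongrightarrow> v i"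
    using finite_index_convergent_subseq[of "{0..<n}" V 1] Vb by auto
  have vlim: "(\<lambda>k. V (\<phi> k) i) \<longlonglongrightarrow> v i" if "i < n" for i using v that by simp
  have "(\<lambda>k. t - 1 / real (Suc k)) \<longlonglongrightarrow> t - 0"
    by (intro tendsto_diff tendsto_const LIMSEQ_Suc[OF lim_1_over_n])
  then have tlim: "(\<lambda>k. t - 1 / real (Suc (\<phi> k))) \<longlonglongrightarrow> t"
    using LIMSEQ_subseq_LIMSEQ[OF _ \<phi>] by (fastforce simp: o_def)
  have sum_lim: "(\<lambda>k. \<Sum>i=0..<n. V (\<phi> k) i) \<longlonglongrightarrow> (\<Sum>i=0..<n. v i)"
    by (intro tendsto_sum vlim) auto
  have Av_lim: "(\<lambda>k. \<Sum>j=0..<n. a i j * V (\<phi> k) j) \<longlonglongrightarrow> (\<Sum>j=0..<n. a i j * v j)" for i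
    by (intro tendsto_sum tendsto_mult tendsto_const vlim) auto
  have v0: "0 \<le> v i" if "i < n" for i
    by (rule LIMSEQ_le_const[OF vlim[OF that]]) (use V that in \<open>auto simp: sub_def\<close>)
  have v1: "(\<Sum>i=0..<n. v i) = 1"
    using sum_lim V by (simp add: sub_def LIMSEQ_const_iff)
  have Av: "t * v i \<le> (\<Sum>j=0..<n. a i j * v j)" if "i < n" for i
    by (rule LIMSEQ_le[OF tendsto_mult[OF tlim vlim[OF that]] Av_lim])
       (use V that in \<open>auto simp: sub_def\<close>)
  define u where "u i = (\<Sum>j=0..<n. a i j * v j)" for i
  obtain l where l: "l < n" "v l > 0"
    using v0 v1 by (metis atLeastLessThan_iff less_eq_real_def sum.neutral zero_neq_one)
  have lin_pos: "0 < (\<Sum>j=0..<n. a i j * z j)"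
    if "i < n" "\<And>j. j < n \<Longrightarrow> 0 \<le> z j" "k < n" "0 < z k" for i k z
    using that pos by (intro sum_pos2[of _ k]) (auto simp: less_imp_le)
  have u_pos: "0 < u i" if "i < n" for i
    unfolding u_def by (rule lin_pos) (use that v0 l in auto)
  have eq: "u i = t * v i" if "i < n" for i
  proof (rule ccontr)
    assume "u i \<noteq> t * v i"
    then have i: "t * v i < u i" using Av[OF that] by (simp add: u_def)
    define U where "U = (\<Sum>i=0..<n. u i)"
    have U: "U > 0" unfolding U_def using u_pos n by (intro sum_pos) auto
    \<comment> \<open>The positive matrix is applied to \<open>u - t v\<close>, which is nonnegative
      and positive at \<open>i\<close>; this makes the inequality for \<open>u\<close> strict in
      every coordinate.\<close>
    have strict: "t * u k < (\<Sum>j=0..<n. a k j * u j)" if "k < n" for k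
    proof -
      have "0 < (\<Sum>j=0..<n. a k j * (u j - t * v j))"
        by (rule lin_pos[OF \<open>k < n\<close> _ \<open>i < n\<close>]) (use Av i in \<open>auto simp: u_def\<close>)
      also have "\<dots> = (\<Sum>j=0..<n. a k j * u j) - t * u k"
        by (simp add: u_def algebra_simps sum_subtractf sum_distrib_left)
      finally show ?thesis by simp
    qed
    \<comment> \<open>The smallest relative slack is positive, and \<open>u\<close>, rescaled to sum
      1, is admissible for \<open>t + e\<close>.\<close>
    define e where "e = Min ((\<lambda>k. ((\<Sum>j=0..<n. a k j * u j) - t * u k) / u k) ` {0..<n})"
    have e: "e > 0" unfolding e_def using n strict u_pos by (subst Min_gr_iff) auto
    have "(t + e) * u k \<le> (\<Sum>j=0..<n. a k j * u j)" if "k < n" for k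
    proof -
      have "e \<le> ((\<Sum>j=0..<n. a k j * u j) - t * u k) / u k"
        unfolding e_def using that by (intro Min_le) auto
      then show ?thesis using u_pos[OF that] by (simp add: field_simps)
    qed
    then have "(t + e) * (u k / U) \<le> (\<Sum>j=0..<n. a k j * (u j / U))" if "k < n" for k
      using that U by (simp add: divide_right_mono flip: sum_divide_distrib)
    moreover have "(\<Sum>i=0..<n. u i / U) = 1" using U by (simp add: U_def flip: sum_divide_distrib)
    ultimately have "sub (t + e) (\<lambda>k. u k / U)"
      using u_pos U by (auto simp: sub_def less_imp_le)
    then have "t + e \<le> t" unfolding t_def by (intro cSup_upper bdd) (auto simp: T_def)
    with e show False by simp
  qed
  have "0 < v i" if "i < n" for i
    using u_pos[OF that] eq[OF that] v0[OF that] by (cases "v i = 0") auto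
  with eq show ?thesis unfolding u_def by blast
qed

text \<open>Conjugation by the diagonal matrix of a Perron vector \<open>v\<close> turns row sum
  \<open>i\<close> into the \<open>i\<close>-th entry of \<open>A v\<close> divided by
  \<open>v i\<close>. The bound on \<open>r\<close> in terms of \<open>A\<close> keeps row sums
  bounded along a perturbation.\<close>

lemma positive_mat_similar_row_sum:
  assumes A: "A \<in> carrier_mat n n" and n: "n > 0"
    and pos: "\<And>i j. i < n \<Longrightarrow> j < n \<Longrightarrow> 0 < A $$ (i, j)"
  shows "\<exists>r B. nonneg_row_sum_mat n r B \<and> char_poly_c B = char_poly_c A \<and>
    r \<le> (\<Sum>i=0..<n. \<Sum>j=0..<n. A $$ (i, j))"
proof -
  obtain v t where v: "\<And>i. i < n \<Longrightarrow> 0 < v i"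
    and t: "\<And>i. i < n \<Longrightarrow> (\<Sum>j=0..<n. A $$ (i, j) * v j) = t * v i"
    using perron_vector[of n "\<lambda>i j. A $$ (i, j)"] n pos by blast
  define P where "P = mat n n (\<lambda>(i, j). if i = j then v i else 0)"
  define Q where "Q = mat n n (\<lambda>(i, j). if i = j then 1 / v i else 0)"
  define B where "B = mat n n (\<lambda>(i, j). A $$ (i, j) * v j / v i)"
  have carr: "P \<in> carrier_mat n n" "Q \<in> carrier_mat n n" "B \<in> carrier_mat n n"
    by (simp_all add: P_def Q_def B_def)
  have P_mult: "(P * X) $$ (i, j) = v i * X $$ (i, j)"
    if "X \<in> carrier_mat n n" "i < n" "j < n" for X i j
  proof -
    have "(P * X) $$ (i, j) = (\<Sum>k=0..<n. if k = i then v i * X $$ (k, j) else 0)"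
      using that by (simp add: P_def scalar_prod_def if_distrib[of "\<lambda>c. c * _"] eq_commute[of i] cong: if_cong)
    then show ?thesis using that by simp
  qed
  have mult_Q: "(X * Q) $$ (i, j) = X $$ (i, j) / v j"
    if "X \<in> carrier_mat n n" "i < n" "j < n" for X i j
  proof -
    have "(X * Q) $$ (i, j) = (\<Sum>k=0..<n. if k = j then X $$ (i, k) / v j else 0)"
      using that by (simp add: Q_def scalar_prod_def if_distrib[of "\<lambda>c. _ * c"] cong: if_cong)
    then show ?thesis using that by simp
  qed
  have PQ: "P * Q = 1\<^sub>m n"
  proof (rule eq_matI)
    fix i j assume "i < dim_row (1\<^sub>m n :: real mat)" "j < dim_col (1\<^sub>m n :: real mat)"
    then show "(P * Q) $$ (i, j) = 1\<^sub>m n $$ (i, j)"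
      using P_mult[OF carr(2), of i j] v[of i] by (auto simp: Q_def)
  qed (simp_all add: P_def Q_def)
  then have QP: "Q * P = 1\<^sub>m n" using mat_mult_left_right_inverse[OF carr(1,2)] by simp
  have "A = P * B * Q"
  proof (rule eq_matI)
    fix i j assume "i < dim_row (P * B * Q)" "j < dim_col (P * B * Q)"
    then have ij: "i < n" "j < n" using carr by auto
    have "P * B \<in> carrier_mat n n" using carr by simp
    then show "A $$ (i, j) = (P * B * Q) $$ (i, j)"
      using mult_Q[of "P * B" i j] P_mult[OF carr(3) ij] ij v[of i] v[of j] by (simp add: B_def)
  qed (use A carr in auto)
  then have "similar_mat A B"
    using PQ QP A carr by (intro similar_matI[of _ _ P Q n]) auto
  then have "char_poly A = char_poly B" by (rule char_poly_similar)
  then have "char_poly_c B = char_poly_c A"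
    using of_real_hom.char_poly_hom[OF A] of_real_hom.char_poly_hom[OF carr(3)] by metis
  moreover have "nonneg_row_sum_mat n t B"
    unfolding nonneg_row_sum_mat_def
  proof (intro conjI allI impI)
    fix i assume i: "i < n"
    have "(\<Sum>j=0..<n. B $$ (i, j)) = (\<Sum>j=0..<n. A $$ (i, j) * v j) / v i"
      using i by (simp add: B_def sum_divide_distrib)
    also have "\<dots> = t" using t[OF i] v[OF i] by simp
    finally show "(\<Sum>j=0..<n. B $$ (i, j)) = t" .
  next
    fix i j assume "i < n" "j < n"
    then show "0 \<le> B $$ (i, j)"
      using v[of i] v[of j] pos[of i j] by (simp add: B_def less_imp_le)
  qed (use carr in simp)
  \<comment> \<open>Sum the eigenvector equation over all rows and bound each \<open>v j\<close> by
    the total \<open>V\<close>.\<close>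
  moreover have "t \<le> (\<Sum>i=0..<n. \<Sum>j=0..<n. A $$ (i, j))"
  proof -
    define V where "V = (\<Sum>i=0..<n. v i)"
    have V: "V > 0" unfolding V_def using v n by (intro sum_pos) auto
    have "t * V = (\<Sum>i=0..<n. \<Sum>j=0..<n. A $$ (i, j) * v j)"
      using t by (simp add: V_def sum_distrib_left)
    also have "\<dots> \<le> (\<Sum>i=0..<n. \<Sum>j=0..<n. A $$ (i, j) * V)"
      using pos v by (intro sum_mono mult_left_mono)
        (auto simp: V_def less_imp_le intro!: member_le_sum)
    also have "\<dots> = (\<Sum>i=0..<n. \<Sum>j=0..<n. A $$ (i, j)) * V"
      by (simp add: sum_distrib_right)
    finally show ?thesis using V by simp
  qed
  ultimately show ?thesis by blast
qed

lemma map_char_poly_row_sum: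
  assumes "nonneg_row_sum_mat (Suc n) r A"
  shows "char_poly_c A = [:- complex_of_real r, 1:] * map_poly complex_of_real (char_poly (deflate A))"
proof -
  have A: "A \<in> carrier_mat (Suc n) (Suc n)"
    and r: "\<And>i. i < Suc n \<Longrightarrow> (\<Sum>j=0..<Suc n. A $$ (i, j)) = r"
    using assms by (simp_all add: nonneg_row_sum_mat_def del: sum.op_ivl_Suc)
  interpret of_real_poly: map_poly_comm_ring_hom complex_of_real ..
  have "char_poly_c A = map_poly complex_of_real ([:- r, 1:] * char_poly (deflate A))"
    by (simp only: of_real_hom.char_poly_hom[OF A] char_poly_deflate[OF A r])
  then show ?thesis by (simp only: of_real_poly.hom_mult) (simp add: hom_distribs)
qed

lemma poly_prod_list_linear_eq_0_iff:
  fixes z :: "'a :: idom"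
  shows "poly (\<Prod>e\<leftarrow>es. [:- e, 1:]) z = 0 \<longleftrightarrow> z \<in> set es"
  by (induction es) auto

section \<open>The set of realizable Perron values\<close>

text \<open>The row sum \<open>s\<close> is kept separate from \<open>r\<close>, since after a limit
  the two need not have been identified yet.\<close>

lemma realizable_of_row_sum:
  assumes "nonneg_row_sum_mat (Suc (length es)) s A"
    and "has_spectrum A (complex_of_real r # es)" "0 \<le> r" "\<forall>z\<in>set es. cmod z \<le> r"
  shows "realizable r es"
  using assms unfolding realizable_def nonneg_row_sum_mat_def by blast

text \<open>This moves \<open>r\<close> out of the spectral condition: the deflated matrix carries
  exactly \<open>es\<close>, and \<open>r\<close> enters only as a row sum.\<close>

lemma realizable_iff_row_sum:
  "realizable r es \<longleftrightarrow> (\<exists>A. nonneg_row_sum_mat (Suc (length es)) r A \<and>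
     map_poly complex_of_real (char_poly (deflate A)) = (\<Prod>e\<leftarrow>es. [:- e, 1:]))"
proof
  let ?n = "Suc (length es)"
  assume "realizable r es"
  then obtain A where A: "A \<in> carrier_mat ?n ?n"
    and nonneg: "\<And>i j. i < ?n \<Longrightarrow> j < ?n \<Longrightarrow> 0 \<le> A $$ (i, j)"
    and spec: "char_poly_c A = (\<Prod>e\<leftarrow>complex_of_real r # es. [:- e, 1:])"
    and r: "0 \<le> r" "\<forall>z\<in>set es. cmod z \<le> r"
    unfolding realizable_def has_spectrum_def by blast
  \<comment> \<open>The perturbation is at most 1, so the sums of entries are bounded uniformly in
    \<open>k\<close>.\<close>
  define A' where "A' k = mat ?n ?n (\<lambda>ij. A $$ ij + 1 / real (Suc k))" for k
  have A': "A' k \<in> carrier_mat ?n ?n" for k by (simp add: A'_def)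
  have A'_pos: "0 < A' k $$ (i, j)" if "i < ?n" "j < ?n" for i j k
    using that nonneg[OF that] by (simp add: A'_def add_nonneg_pos)
  have "\<exists>s B. nonneg_row_sum_mat ?n s B \<and> char_poly_c B = char_poly_c (A' k) \<and>
    s \<le> (\<Sum>i=0..<?n. \<Sum>j=0..<?n. A' k $$ (i, j))" for k
    by (rule positive_mat_similar_row_sum[OF A' _ A'_pos]) simp_all
  then obtain s B where B: "\<And>k. nonneg_row_sum_mat ?n (s k) (B k)"
    and cB: "\<And>k. char_poly_c (B k) = char_poly_c (A' k)"
    and s: "\<And>k. s k \<le> (\<Sum>i=0..<?n. \<Sum>j=0..<?n. A' k $$ (i, j))"
    by metis
  have "(\<lambda>k. A $$ (i, j) + 1 / real (Suc k)) \<longlonglongrightarrow> A $$ (i, j) + 0" for i j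
    by (intro tendsto_add tendsto_const LIMSEQ_Suc[OF lim_1_over_n])
  then have lim: "(\<lambda>k. A' k $$ (i, j)) \<longlonglongrightarrow> A $$ (i, j)" if "i < ?n" "j < ?n" for i j
    using that by (simp add: A'_def)
  have "s k \<le> (\<Sum>i=0..<?n. \<Sum>j=0..<?n. A $$ (i, j) + 1)" for k
    by (rule order_trans[OF s], intro sum_mono) (simp add: A'_def)
  moreover have "(\<lambda>k. poly (char_poly_c (B k)) z) \<longlonglongrightarrow> poly (char_poly_c A) z" for z
    unfolding cB
  proof (rule tendsto_char_poly)
    fix i j assume "i < ?n" "j < ?n"
    then show "(\<lambda>k. map_mat complex_of_real (A' k) $$ (i, j))
      \<longlonglongrightarrow> map_mat complex_of_real A $$ (i, j)"
      using tendsto_of_real[OF lim, of i j] A carrier_matD[OF A'] by simp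
  qed (use A A' in auto)
  ultimately obtain t C where C: "nonneg_row_sum_mat ?n t C" "char_poly_c C = char_poly_c A"
    using nonneg_row_sum_mat_limit[of ?n s B _ "char_poly_c A"] B by blast
  have prod: "[:- complex_of_real t, 1:] * map_poly complex_of_real (char_poly (deflate C)) =
    (\<Prod>e\<leftarrow>complex_of_real r # es. [:- e, 1:])"
    using map_char_poly_row_sum[OF C(1)] C(2) spec by metis
  \<comment> \<open>The row sum \<open>t\<close> of the limit equals \<open>r\<close>: the root
    \<open>r\<close> is at most \<open>t\<close>, and \<open>t\<close> is a root, hence
    \<open>r\<close> itself or a member of \<open>es\<close> dominated by \<open>r\<close>.\<close>
  have "poly (char_poly_c C) (complex_of_real r) = 0"
    using C(2) spec by simp
  then have "r \<le> t"
    using nonneg_row_sum_mat_root_le[OF C(1)] r(1) by fastforce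
  moreover have "complex_of_real t \<in> set (complex_of_real r # es)"
    using arg_cong[OF prod, of "\<lambda>P. poly P (complex_of_real t)"]
    unfolding poly_prod_list_linear_eq_0_iff[symmetric] by simp
  then have "t \<le> r" using r by auto
  ultimately have "t = r" by simp
  then have "map_poly complex_of_real (char_poly (deflate C)) = (\<Prod>e\<leftarrow>es. [:- e, 1:])"
    using prod by (simp del: mult_pCons_left)
  with C(1) \<open>t = r\<close> show "\<exists>A. nonneg_row_sum_mat ?n r A \<and>
     map_poly complex_of_real (char_poly (deflate A)) = (\<Prod>e\<leftarrow>es. [:- e, 1:])" by blast
next
  let ?n = "Suc (length es)"
  assume "\<exists>A. nonneg_row_sum_mat ?n r A \<and>
     map_poly complex_of_real (char_poly (deflate A)) = (\<Prod>e\<leftarrow>es. [:- e, 1:])"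
  then obtain A where A: "nonneg_row_sum_mat ?n r A"
    and p: "map_poly complex_of_real (char_poly (deflate A)) = (\<Prod>e\<leftarrow>es. [:- e, 1:])" by blast
  have spec: "has_spectrum A (complex_of_real r # es)"
    unfolding has_spectrum_def map_char_poly_row_sum[OF A] p by simp
  have "cmod z \<le> r" if "z \<in> set (complex_of_real r # es)" for z
    using nonneg_row_sum_mat_root_le[OF A, of z] that spec
    unfolding has_spectrum_def poly_prod_list_linear_eq_0_iff[symmetric] by simp
  moreover have "0 \<le> r"
    using nonneg_row_sum_mat_entry_le[OF A, of 0 0] by simp
  ultimately show "realizable r es"
    using realizable_of_row_sum[OF A spec] by simp
qed

text \<open>With \<open>char_poly_deflate\<close> this is Brauer's theorem on the rank-one perturbation \<open>A + e q\<^sup>T\<close>.\<close>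

lemma deflate_add_row:
  assumes "A \<in> carrier_mat n n"
  shows "deflate (mat n n (\<lambda>(i, j). A $$ (i, j) + q j)) = deflate A"
  using assms by (intro eq_matI) (auto simp: deflate_def)

lemma row_sum_add_row:
  assumes "A \<in> carrier_mat n n" "i < n" "(\<Sum>j=0..<n. A $$ (i, j)) = r"
  shows "(\<Sum>j=0..<n. mat n n (\<lambda>(i, j). A $$ (i, j) + q j) $$ (i, j)) = r + (\<Sum>j=0..<n. q j)"
  using assms by (simp add: sum.distrib)

lemma realizable_mono:
  assumes "realizable r es" "r \<le> r'"
  shows "realizable r' es"
proof -
  let ?n = "Suc (length es)"
  obtain A where A: "nonneg_row_sum_mat ?n r A"
    and p: "map_poly complex_of_real (char_poly (deflate A)) = (\<Prod>e\<leftarrow>es. [:- e, 1:])"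
    using assms(1) unfolding realizable_iff_row_sum by blast
  have c: "A \<in> carrier_mat ?n ?n" using A by (simp add: nonneg_row_sum_mat_def)
  \<comment> \<open>The whole increase goes into column 0; the deflated matrix does not see
    it.\<close>
  define q where "q j = (if j = 0 then r' - r else 0)" for j :: nat
  define B where "B = mat ?n ?n (\<lambda>(i, j). A $$ (i, j) + q j)"
  have "(\<Sum>j=0..<?n. q j) = r' - r" by (simp add: q_def del: sum.op_ivl_Suc)
  then have "(\<Sum>j=0..<?n. B $$ (i, j)) = r'" if "i < ?n" for i
    using row_sum_add_row[OF c that, of r q] A that
    unfolding B_def nonneg_row_sum_mat_def by simp
  moreover have "0 \<le> B $$ (i, j)" if "i < ?n" "j < ?n" for i j
    using A that assms(2) by (simp add: B_def q_def nonneg_row_sum_mat_def)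
  ultimately have "nonneg_row_sum_mat ?n r' B"
    unfolding nonneg_row_sum_mat_def B_def by simp
  moreover have "deflate B = deflate A" unfolding B_def by (rule deflate_add_row[OF c])
  ultimately show ?thesis using p unfolding realizable_iff_row_sum by metis
qed

lemma realizable_nonneg: "realizable r es \<Longrightarrow> 0 \<le> r"
  by (auto simp: realizable_def)

lemma realizable_ge: "realizable r es \<Longrightarrow> z \<in> set es \<Longrightarrow> cmod z \<le> r"
  by (auto simp: realizable_def)

text \<open>The characteristic polynomials differ only in the factor \<open>X - s k\<close>, so they
  converge pointwise, and compactness supplies a realizing matrix.\<close>

lemma realizable_limit:
  assumes s: "\<And>k. realizable (s k) es" and lim: "s \<longlonglongrightarrow> r"
  shows "realizable r es"
proof -
  let ?n = "Suc (length es)"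
  obtain A where A: "\<And>k. nonneg_row_sum_mat ?n (s k) (A k)"
    and p: "\<And>k. map_poly complex_of_real (char_poly (deflate (A k))) = (\<Prod>e\<leftarrow>es. [:- e, 1:])"
    using s unfolding realizable_iff_row_sum by metis
  obtain M where M: "\<And>k. norm (s k) \<le> M"
    using convergent_imp_Bseq[OF convergentI[OF lim]] unfolding Bseq_def by blast
  then have "s k \<le> M" for k using abs_le_D1[of "s k" M] by simp
  moreover have "(\<lambda>k. poly (char_poly_c (A k)) z) \<longlonglongrightarrow>
    poly (\<Prod>e\<leftarrow>complex_of_real r # es. [:- e, 1:]) z" for z
    unfolding map_char_poly_row_sum[OF A] p using lim
    by (auto intro!: tendsto_intros simp: algebra_simps)
  ultimately obtain t B where B: "nonneg_row_sum_mat ?n t B"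
      "char_poly_c B = (\<Prod>e\<leftarrow>complex_of_real r # es. [:- e, 1:])"
    using nonneg_row_sum_mat_limit[of ?n s A M] A by blast
  show ?thesis
  proof (rule realizable_of_row_sum[OF B(1)])
    show "0 \<le> r" by (rule LIMSEQ_le_const[OF lim]) (use s realizable_nonneg in blast)
    show "\<forall>z\<in>set es. cmod z \<le> r"
      by (intro ballI LIMSEQ_le_const[OF lim]) (use s realizable_ge in blast)
  qed (use B(2) in \<open>simp add: has_spectrum_def\<close>)
qed

section \<open>Adjoining eigenvalues\<close>

text \<open>The block \<open>C\<close> does not affect the spectrum, so it is free for adjusting row
  sums.\<close>

lemma char_poly_four_block_upper_right_zero:
  fixes A :: "'a :: idom mat"
  assumes A: "A \<in> carrier_mat n n" and C: "C \<in> carrier_mat m n" and D: "D \<in> carrier_mat m m"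
  shows "char_poly (four_block_mat A (0\<^sub>m n m) C D) = char_poly A * char_poly D"
proof -
  have "char_poly_matrix (four_block_mat A (0\<^sub>m n m) C D) =
    four_block_mat (char_poly_matrix A) (0\<^sub>m n m) (map_mat (\<lambda>a. [:- a:]) C) (char_poly_matrix D)"
    by (rule eq_matI) (use A C D in \<open>auto simp: char_poly_matrix_def one_poly_def\<close>)
  then show ?thesis
    unfolding char_poly_def using A C D by (simp add: det_four_block_mat_upper_right_zero[of _ n _ m])
qed

lemma char_poly_mat_2:
  fixes a :: "'a :: comm_ring_1"
  shows "char_poly (mat 2 2 (\<lambda>(i, j). if i = 0 then (if j = 0 then a else b) else (if j = 0 then c else d)))
    = [:a * d - b * c, - a - d, 1:]"
proof -
  have det2: "det M = M $$ (0, 0) * M $$ (1, 1) - M $$ (1, 0) * M $$ (0, 1)"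
    if "M \<in> carrier_mat 2 2" for M :: "'a poly mat"
    using laplace_expansion_column[OF that, of 0] that
    by (simp add: numeral_2_eq_2 cofactor_def mat_delete_def det_single)
  show ?thesis
    unfolding char_poly_def
    by (subst det2) (simp_all add: char_poly_matrix_def algebra_simps)
qed

text \<open>The new rows \<open>C\<close>, \<open>D\<close> may have negative entries as long as
  adding \<open>q\<close> repairs them; the old rows stay nonnegative because \<open>q\<close> is.
  The cost is the total of \<open>q\<close>.\<close>

lemma append_block:
  assumes A: "nonneg_row_sum_mat (Suc m) r A"
    and C: "C \<in> carrier_mat k (Suc m)" and D: "D \<in> carrier_mat k k"
    and sum: "\<And>i. i < k \<Longrightarrow> (\<Sum>j=0..<Suc m. C $$ (i, j)) + (\<Sum>j=0..<k. D $$ (i, j)) = r"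
    and q: "\<And>j. 0 \<le> q j"
    and Cq: "\<And>i j. i < k \<Longrightarrow> j < Suc m \<Longrightarrow> 0 \<le> C $$ (i, j) + q j"
    and Dq: "\<And>i j. i < k \<Longrightarrow> j < k \<Longrightarrow> 0 \<le> D $$ (i, j) + q (Suc m + j)"
    and r': "r' = r + (\<Sum>j=0..<Suc m + k. q j)"
  shows "\<exists>B. nonneg_row_sum_mat (Suc m + k) r' B \<and>
    char_poly (deflate B) = char_poly (deflate A) * char_poly D"
proof -
  let ?n = "Suc m + k"
  have Ac: "A \<in> carrier_mat (Suc m) (Suc m)" using A by (simp add: nonneg_row_sum_mat_def)
  define F where "F = four_block_mat A (0\<^sub>m (Suc m) k) C D"
  have F: "F \<in> carrier_mat ?n ?n" using Ac D unfolding F_def by (rule four_block_carrier_mat)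
  have F_ix: "F $$ (i, j) = (if i < Suc m then if j < Suc m then A $$ (i, j) else 0
      else if j < Suc m then C $$ (i - Suc m, j) else D $$ (i - Suc m, j - Suc m))"
    if "i < ?n" "j < ?n" for i j
    using that Ac C D by (simp add: F_def)
  have F_sum: "(\<Sum>j=0..<?n. F $$ (i, j)) = r" if i: "i < ?n" for i
  proof -
    have "(\<Sum>j=0..<?n. F $$ (i, j)) = (\<Sum>j=0..<Suc m. F $$ (i, j)) + (\<Sum>j=Suc m..<?n. F $$ (i, j))"
      by (rule sum.atLeastLessThan_concat[symmetric]) auto
    also have "(\<Sum>j=Suc m..<?n. F $$ (i, j)) = (\<Sum>j=0..<k. F $$ (i, j + Suc m))"
      using sum.shift_bounds_nat_ivl[of "\<lambda>j. F $$ (i, j)" 0 "Suc m" k] by (simp add: add.commute)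
    also have "(\<Sum>j=0..<Suc m. F $$ (i, j)) + \<dots> = r"
    proof (cases "i < Suc m")
      case True
      then show ?thesis using i A by (simp add: F_ix nonneg_row_sum_mat_def del: sum.op_ivl_Suc)
    next
      case False
      then show ?thesis using i sum[of "i - Suc m"] by (simp add: F_ix del: sum.op_ivl_Suc)
    qed
    finally show ?thesis .
  qed
  define B where "B = mat ?n ?n (\<lambda>(i, j). F $$ (i, j) + q j)"
  \<comment> \<open>Both \<open>F\<close> and \<open>A\<close> have row sums \<open>r\<close>, so
    the common factor can be cancelled.\<close>
  have "[:- r, 1:] * char_poly (deflate F) = [:- r, 1:] * (char_poly (deflate A) * char_poly D)"
  proof -
    have "char_poly F = [:- r, 1:] * char_poly (deflate F)"
      using char_poly_deflate[of F "m + k" r] F F_sum by simp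
    moreover have "char_poly A = [:- r, 1:] * char_poly (deflate A)"
      using char_poly_deflate[OF Ac, of r] A by (simp add: nonneg_row_sum_mat_def)
    moreover have "char_poly F = char_poly A * char_poly D"
      unfolding F_def by (rule char_poly_four_block_upper_right_zero[OF Ac C D])
    ultimately show ?thesis by (simp only: mult.assoc)
  qed
  then have "char_poly (deflate F) = char_poly (deflate A) * char_poly D"
    by (simp del: mult_pCons_left)
  moreover have "deflate B = deflate F" unfolding B_def by (rule deflate_add_row[OF F])
  moreover have "nonneg_row_sum_mat ?n r' B"
    unfolding nonneg_row_sum_mat_def
  proof (intro conjI allI impI)
    fix i assume "i < ?n"
    then show "(\<Sum>j=0..<?n. B $$ (i, j)) = r'"
      unfolding B_def r' by (intro row_sum_add_row[OF F] F_sum)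
  next
    fix i j assume ij: "i < ?n" "j < ?n"
    show "0 \<le> B $$ (i, j)"
      using ij A q[of j] Cq[of "i - Suc m" j] Dq[of "i - Suc m" "j - Suc m"]
      by (auto simp: B_def F_ix nonneg_row_sum_mat_def)
  qed (simp add: B_def)
  ultimately show ?thesis by metis
qed

lemma append_real:
  assumes A: "nonneg_row_sum_mat (Suc m) r A" and "\<bar>\<mu>\<bar> \<le> W" "W \<le> r"
  shows "\<exists>B. nonneg_row_sum_mat (Suc m + 1) (r + W) B \<and>
    char_poly (deflate B) = char_poly (deflate A) * [:- \<mu>, 1:]"
proof -
  \<comment> \<open>Column 0 fills the row sum, with \<open>r - \<mu> \<ge> 0\<close> since
    \<open>\<mu> \<le> W \<le> r\<close>; only the new diagonal entry may need the added
    \<open>W\<close>.\<close>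
  define C where "C = mat 1 (Suc m) (\<lambda>(i, j). if j = 0 then r - \<mu> else 0)"
  define D where "D = mat 1 1 (\<lambda>_. \<mu>)"
  define q where "q j = (if j = Suc m then W else 0)" for j :: nat
  have "char_poly D = [:- \<mu>, 1:]"
    by (simp add: char_poly_defs D_def det_single)
  moreover have "\<exists>B. nonneg_row_sum_mat (Suc m + 1) (r + W) B \<and>
    char_poly (deflate B) = char_poly (deflate A) * char_poly D"
    by (rule append_block[OF A, of C _ _ q]) (use assms in \<open>auto simp: C_def D_def q_def\<close>)
  ultimately show ?thesis by simp
qed

text \<open>If \<open>x \<le> 0\<close>, then \<open>W\<close> is added to the two new columns. If \<open>x > 0\<close>, the row sum available for
  the old columns may be negative, but the second new column is already nonnegative; so the negative
  part is put into column 1, to which \<open>W\<close> is added instead.\<close>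

lemma append_conj_pair:
  assumes A: "nonneg_row_sum_mat (Suc m) r A" and m: "0 < m"
    and "\<bar>x\<bar> \<le> W" "\<bar>y\<bar> \<le> W" "W \<le> r"
  shows "\<exists>B. nonneg_row_sum_mat (Suc m + 2) (r + 2 * W) B \<and>
    char_poly (deflate B) = char_poly (deflate A) * [:x\<^sup>2 + y\<^sup>2, - 2 * x, 1:]"
proof -
  \<comment> \<open>This block has eigenvalues \<open>x + iy\<close> and \<open>x - iy\<close>.
    Using \<open>\<bar>y\<bar>\<close> puts the negative off-diagonal entry into the first new
    column whatever the sign of \<open>y\<close>.\<close>
  define D where "D = mat 2 2 (\<lambda>(i, j). if i = 0 then (if j = 0 then x else \<bar>y\<bar>)
    else (if j = 0 then - \<bar>y\<bar> else x))"
  have cD: "char_poly D = [:x\<^sup>2 + y\<^sup>2, - 2 * x, 1:]"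
    unfolding D_def char_poly_mat_2 by (simp add: power2_eq_square)
  have sum2: "(\<Sum>j=0..<2. f j) = f 0 + f 1" for f :: "nat \<Rightarrow> real"
    by (simp add: numeral_2_eq_2)
  have W: "0 \<le> W" using assms(3) by simp
  have less2: "i < 2 \<longleftrightarrow> i = 0 \<or> i = 1" for i :: nat by auto
  have D_sum: "(\<Sum>j=0..<2. D $$ (i, j)) = (if i = 0 then x + \<bar>y\<bar> else x - \<bar>y\<bar>)" if "i < 2" for i
    using that by (auto simp: sum2 D_def)
  show ?thesis
  proof (cases "x \<le> 0")
    case True
    \<comment> \<open>Since \<open>x \<le> 0\<close> and
      \<open>\<bar>y\<bar> \<le> W \<le> r\<close>, column 0 can absorb the missing row sum without
      becoming negative.\<close>
    define C where "C = mat 2 (Suc m) (\<lambda>(i, j). if j = 0 then (if i = 0 then r - x - \<bar>y\<bar>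
      else r - x + \<bar>y\<bar>) else 0)"
    define q where "q j = (if j \<in> {Suc m..<Suc m + 2} then W else 0)" for j :: nat
    have "(\<Sum>j=0..<Suc m + 2. q j) = (\<Sum>j=Suc m..<Suc m + 2. W)"
      unfolding q_def by (subst sum.inter_restrict[symmetric]) (auto intro: sum.cong)
    then have q: "(\<Sum>j=0..<Suc m + 2. q j) = 2 * W" by simp
    have "\<exists>B. nonneg_row_sum_mat (Suc m + 2) (r + 2 * W) B \<and>
      char_poly (deflate B) = char_poly (deflate A) * char_poly D"
    proof (rule append_block[OF A, of C _ _ q])
      fix i :: nat assume "i < 2"
      then show "(\<Sum>j=0..<Suc m. C $$ (i, j)) + (\<Sum>j=0..<2. D $$ (i, j)) = r"
        by (simp add: D_sum C_def del: sum.op_ivl_Suc)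
    next
      fix i j :: nat assume "i < 2" "j < Suc m"
      then show "0 \<le> C $$ (i, j) + q j"
        using True assms by (auto simp: C_def q_def)
    next
      fix i j :: nat assume "i < 2" "j < 2"
      then show "0 \<le> D $$ (i, j) + q (Suc m + j)"
        using assms by (auto simp: D_def q_def)
    qed (use W q in \<open>simp_all add: C_def D_def q_def del: sum.op_ivl_Suc\<close>)
    then show ?thesis unfolding cD .
  next
    case False
    define C where "C = mat 2 (Suc m) (\<lambda>(i, j). if j = 0 then r - x
      else if j = 1 then (if i = 0 then - \<bar>y\<bar> else \<bar>y\<bar>) else 0)"
    \<comment> \<open>\<open>0 < m\<close> ensures that column 1 is an old column, so the two
      indices are distinct and the cost is again \<open>2 * W\<close>.\<close>
    define q where "q j = (if j \<in> {1, Suc m} then W else 0)" for j :: nat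
    have "(\<Sum>j=0..<Suc m + 2. q j) = (\<Sum>j\<in>{1, Suc m}. W)"
      unfolding q_def by (subst sum.inter_restrict[symmetric]) (auto intro: sum.cong)
    then have q: "(\<Sum>j=0..<Suc m + 2. q j) = 2 * W" using m by simp
    have C_sum: "(\<Sum>j=0..<Suc m. C $$ (i, j)) = (if i = 0 then r - x - \<bar>y\<bar> else r - x + \<bar>y\<bar>)"
      if "i < 2" for i
    proof -
      have "(\<Sum>j=0..<Suc m. C $$ (i, j)) = (\<Sum>j\<in>{0, 1}. C $$ (i, j))"
        by (rule sum.mono_neutral_right) (use that m in \<open>auto simp: C_def\<close>)
      then show ?thesis using that m by (simp add: C_def)
    qed
    have "\<exists>B. nonneg_row_sum_mat (Suc m + 2) (r + 2 * W) B \<and>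
      char_poly (deflate B) = char_poly (deflate A) * char_poly D"
    proof (rule append_block[OF A, of C _ _ q])
      fix i :: nat assume "i < 2"
      then show "(\<Sum>j=0..<Suc m. C $$ (i, j)) + (\<Sum>j=0..<2. D $$ (i, j)) = r"
        by (simp add: D_sum C_sum del: sum.op_ivl_Suc)
    next
      fix i j :: nat assume "i < 2" "j < Suc m"
      then show "0 \<le> C $$ (i, j) + q j"
        using False assms by (auto simp: C_def q_def)
    next
      fix i j :: nat assume "i < 2" "j < 2"
      then show "0 \<le> D $$ (i, j) + q (Suc m + j)"
        using False assms m by (auto simp: D_def q_def less2)
    qed (use W q in \<open>simp_all add: C_def D_def q_def del: sum.op_ivl_Suc\<close>)
    then show ?thesis unfolding cD .
  qed
qed

text \<open>The invariant is row sum \<open>(size - 1) * W\<close>. From size 2 on it is at least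
  \<open>W\<close>, as the appending lemmas require; a pair also needs an old column 1, which the
  real start provides.\<close>

lemma realize_real_and_conj_pair:
  fixes lam :: "nat \<Rightarrow> complex"
  assumes real_le: "\<And>i. i \<in> {2..p} \<Longrightarrow> \<bar>Re (lam i)\<bar> \<le> W" and p: "2 \<le> p"
    and pair_le: "\<And>i. i \<in> {p+1..p+l} \<Longrightarrow> \<bar>Re (lam i)\<bar> \<le> W \<and> \<bar>Im (lam i)\<bar> \<le> W"
  shows "\<exists>A. nonneg_row_sum_mat (p + 2 * l) ((real (p + 2 * l) - 1) * W) A \<and>
    char_poly (deflate A) = (\<Prod>i=2..p. [:- Re (lam i), 1:]) *
      (\<Prod>i=p+1..p+l. [:(Re (lam i))\<^sup>2 + (Im (lam i))\<^sup>2, - 2 * Re (lam i), 1:])"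
  using pair_le
proof (induction l)
  case 0
  have "\<exists>A. nonneg_row_sum_mat k ((real k - 1) * W) A \<and>
    char_poly (deflate A) = (\<Prod>i=2..k. [:- Re (lam i), 1:])" if "2 \<le> k" "k \<le> p" for k
    using that
  proof (induction k rule: dec_induct)
    case base
    define \<mu> where "\<mu> = Re (lam 2)"
    \<comment> \<open>The symmetric 2 by 2 matrix with eigenvalues \<open>W\<close> and
      \<open>\<mu>\<close>, nonnegative because \<open>\<bar>\<mu>\<bar> \<le> W\<close>.\<close>
    define A where "A = mat 2 2 (\<lambda>(i, j). if i = j then (W + \<mu>) / 2 else (W - \<mu>) / 2 :: real)"
    have "\<bar>\<mu>\<bar> \<le> W" unfolding \<mu>_def by (rule real_le) (use base in auto)
    then have "nonneg_row_sum_mat 2 W A"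
      by (auto simp: nonneg_row_sum_mat_def A_def numeral_2_eq_2 less_Suc_eq field_simps)
    moreover have "char_poly (deflate A) = [:- \<mu>, 1:]"
      by (simp add: deflate_def A_def char_poly_defs det_single field_simps)
    ultimately show ?case by (auto simp: \<mu>_def)
  next
    case (step k)
    then obtain A where A: "nonneg_row_sum_mat k ((real k - 1) * W) A"
      and cA: "char_poly (deflate A) = (\<Prod>i=2..k. [:- Re (lam i), 1:])" by auto
    have mu: "\<bar>Re (lam (Suc k))\<bar> \<le> W" by (rule real_le) (use step in auto)
    then have "1 * W \<le> (real k - 1) * W" using step by (intro mult_right_mono) auto
    then obtain B where "nonneg_row_sum_mat (k + 1) ((real k - 1) * W + W) B"
      "char_poly (deflate B) = char_poly (deflate A) * [:- Re (lam (Suc k)), 1:]"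
      using append_real[of "k - 1" _ A, OF _ mu] A step by auto
    then show ?case using step cA
      by (intro exI[of _ B]) (simp add: algebra_simps prod.nat_ivl_Suc')
  qed
  from this[of p] show ?case using p by simp
next
  case (Suc l)
  let ?n = "p + 2 * l" and ?i = "p + Suc l"
  obtain A where A: "nonneg_row_sum_mat ?n ((real ?n - 1) * W) A"
    and cA: "char_poly (deflate A) = (\<Prod>i=2..p. [:- Re (lam i), 1:]) *
      (\<Prod>i=p+1..p+l. [:(Re (lam i))\<^sup>2 + (Im (lam i))\<^sup>2, - 2 * Re (lam i), 1:])"
    using Suc by auto
  have W: "\<bar>Re (lam ?i)\<bar> \<le> W" "\<bar>Im (lam ?i)\<bar> \<le> W" using Suc.prems[of ?i] by auto
  then have "1 * W \<le> (real ?n - 1) * W" using p by (intro mult_right_mono) auto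
  then obtain B where "nonneg_row_sum_mat (?n + 2) ((real ?n - 1) * W + 2 * W) B"
    "char_poly (deflate B) = char_poly (deflate A) *
      [:(Re (lam ?i))\<^sup>2 + (Im (lam ?i))\<^sup>2, - 2 * Re (lam ?i), 1:]"
    using append_conj_pair[of "?n - 1" _ A, OF _ _ W] A p by auto
  then show ?case using cA
    by (intro exI[of _ B]) (simp add: algebra_simps prod.nat_ivl_Suc' del: mult_pCons_left mult_pCons_right)
qed

lemma prod_mset_image_mset_set:
  "finite I \<Longrightarrow> prod_mset (image_mset f (mset_set I)) = (\<Prod>i\<in>I. f i)"
  by (rule prod_unfold_prod_mset[symmetric])

section \<open>The least realizable Perron value and its bounds\<close>

theorem theorem3p3:
  fixes n p :: nat
    and lam :: "nat \<Rightarrow> complex"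
    and x y :: "nat \<Rightarrow> real"
    and w :: real
  assumes p_ge: "2 \<le> p" and p_le: "p \<le> n"
    and closed: "image_mset cnj (image_mset lam (mset_set {2..n})) = image_mset lam (mset_set {2..n})"
    and reals: "\<forall>i\<in>{2..p}. lam i \<in> \<real>"
    and ordered: "\<forall>i\<in>{2..p}. \<forall>j\<in>{2..p}. i \<le> j \<longrightarrow> Re (lam j) \<le> Re (lam i)"
    and nonreals: "\<forall>i\<in>{p+1..n}. lam i \<notin> \<real>"
    and pairs: "image_mset lam (mset_set {(n+p) div 2 + 1..n})
                = image_mset cnj (image_mset lam (mset_set {p+1..(n+p) div 2}))"
    and x: "\<forall>i\<in>{p+1..(n+p) div 2}. x i = Re (lam i)"
    and y: "\<forall>i\<in>{p+1..(n+p) div 2}. y i = Im (lam i)"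
    and w: "w = Min ((\<Union>i\<in>{2..p}. {Re (lam i), - Re (lam i)})
                   \<union> (\<Union>i\<in>{p+1..(n+p) div 2}. {x i, - x i, y i, - y i}))"
  shows "\<exists>lam0 :: real. is_arg_min (\<lambda>t. t)
           (\<lambda>t. Max ((\<lambda>j. cmod (lam j)) ` {2..n}) \<le> t
              \<and> t \<le> (real n - 1) * \<bar>w\<bar>
              \<and> (\<forall>lam1 :: real. realizable lam1 (map lam [2..<Suc n]) \<longleftrightarrow> t \<le> lam1))
           lam0"
proof -
  let ?es = "map lam [2..<Suc n]"
  define h where "h = (n + p) div 2"
  define l where "l = h - p"
  \<comment> \<open>Conjugation matches the two index ranges in size, so \<open>n - p\<close> is
    even and the division in \<open>h\<close> is exact.\<close>
  have "size (image_mset lam (mset_set {h + 1..n})) =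
    size (image_mset cnj (image_mset lam (mset_set {p+1..h})))"
    using pairs by (simp add: h_def)
  then have "n - h = h - p" by simp
  moreover have "p \<le> h" "h \<le> n" using p_le by (auto simp: h_def)
  ultimately have n: "n = p + 2 * l" and h: "h = p + l" by (auto simp: l_def)
  define S where "S = (\<Union>i\<in>{2..p}. {Re (lam i), - Re (lam i)})
    \<union> (\<Union>i\<in>{p+1..h}. {x i, - x i, y i, - y i})"
  have S: "finite S" "w = Min S" using w by (auto simp: S_def h_def)
  \<comment> \<open>As \<open>S\<close> is symmetric about 0, its minimum is minus the largest
    absolute value.\<close>
  have S_neg: "- s \<in> S" if "s \<in> S" for s using that by (auto simp: S_def)
  have abs_w: "\<bar>s\<bar> \<le> \<bar>w\<bar>" if "s \<in> S" for s
    using Min_le[OF S(1) that] Min_le[OF S(1) S_neg[OF that]] S(2) by linarith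
  have "\<exists>A. nonneg_row_sum_mat (p + 2 * l) ((real (p + 2 * l) - 1) * \<bar>w\<bar>) A \<and>
    char_poly (deflate A) = (\<Prod>i=2..p. [:- Re (lam i), 1:]) *
      (\<Prod>i=p+1..p+l. [:(Re (lam i))\<^sup>2 + (Im (lam i))\<^sup>2, - 2 * Re (lam i), 1:])"
  proof (rule realize_real_and_conj_pair[OF _ p_ge])
    fix i assume "i \<in> {2..p}"
    then show "\<bar>Re (lam i)\<bar> \<le> \<bar>w\<bar>" by (intro abs_w) (auto simp: S_def)
  next
    fix i assume "i \<in> {p+1..p+l}"
    then have "x i \<in> S" "y i \<in> S" "x i = Re (lam i)" "y i = Im (lam i)"
      using x y by (auto simp: S_def h_def[symmetric] h)
    then show "\<bar>Re (lam i)\<bar> \<le> \<bar>w\<bar> \<and> \<bar>Im (lam i)\<bar> \<le> \<bar>w\<bar>"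
      using abs_w by metis
  qed
  then obtain A where A: "nonneg_row_sum_mat n ((real n - 1) * \<bar>w\<bar>) A"
    and cA: "char_poly (deflate A) = (\<Prod>i=2..p. [:- Re (lam i), 1:]) *
      (\<Prod>i=p+1..h. [:(Re (lam i))\<^sup>2 + (Im (lam i))\<^sup>2, - 2 * Re (lam i), 1:])"
    by (auto simp: n h)
  define f where "f z = [:- z, 1:]" for z :: complex
  have "map_poly complex_of_real (char_poly (deflate A)) = (\<Prod>i=2..p. f (lam i)) *
    (\<Prod>i=p+1..h. f (lam i) * f (cnj (lam i)))"
  proof -
    interpret of_real_poly: map_poly_comm_ring_hom complex_of_real ..
    have "map_poly complex_of_real [:- Re (lam i), 1:] = f (lam i)" if "i \<in> {2..p}" for i
      using reals that by (simp add: f_def hom_distribs)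
    moreover have "map_poly complex_of_real [:(Re z)\<^sup>2 + (Im z)\<^sup>2, - 2 * Re z, 1:] = f z * f (cnj z)" for z
      by (simp add: f_def hom_distribs complex_eq_iff power2_eq_square)
    ultimately show ?thesis
      unfolding cA of_real_poly.hom_mult of_real_poly.hom_prod by simp
  qed
  \<comment> \<open>The conjugates of the chosen representatives are, as a multiset, the entries
    with indices beyond \<open>h\<close>.\<close>
  also have "\<dots> = (\<Prod>i=2..p. f (lam i)) * ((\<Prod>i=p+1..h. f (lam i)) * (\<Prod>i=h+1..n. f (lam i)))"
  proof -
    have "prod_mset (image_mset f (image_mset lam (mset_set {h+1..n}))) =
      prod_mset (image_mset f (image_mset cnj (image_mset lam (mset_set {p+1..h}))))"
      using pairs by (simp add: h_def)
    then have "(\<Prod>i=h+1..n. f (lam i)) = (\<Prod>i=p+1..h. f (cnj (lam i)))"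
      by (simp add: image_mset.compositionality prod_mset_image_mset_set o_def)
    then show ?thesis by (simp add: prod.distrib)
  qed
  also have "\<dots> = (\<Prod>i=2..n. f (lam i))"
  proof -
    have "{2..n} = {2..p} \<union> ({p+1..h} \<union> {h+1..n})" using p_ge n h by auto
    moreover have "{2..p} \<inter> ({p+1..h} \<union> {h+1..n}) = {}" "{p+1..h} \<inter> {h+1..n} = {}"
      using h by auto
    ultimately show ?thesis
      by (simp only: prod.union_disjoint finite_Un finite_atLeastAtMost simp_thms)
  qed
  also have "\<dots> = (\<Prod>e\<leftarrow>?es. [:- e, 1:])"
    using prod.distinct_set_conv_list[of "[2..<Suc n]" "\<lambda>i. f (lam i)"]
    by (simp only: distinct_upt set_upt atLeastLessThanSuc_atLeastAtMost map_map o_def f_def simp_thms)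
  finally have "map_poly complex_of_real (char_poly (deflate A)) = (\<Prod>e\<leftarrow>?es. [:- e, 1:])" .
  moreover have "Suc (length ?es) = n" using p_ge p_le by simp
  ultimately have upper: "realizable ((real n - 1) * \<bar>w\<bar>) ?es"
    using A unfolding realizable_iff_row_sum by metis
  define R where "R = {r. realizable r ?es}"
  have top: "(real n - 1) * \<bar>w\<bar> \<in> R" using upper by (simp add: R_def)
  have bdd: "bdd_below R"
    by (rule bdd_belowI[of _ 0]) (auto simp: R_def dest: realizable_nonneg)
  define lam0 where "lam0 = Inf R"
  \<comment> \<open>A sequence of realizable values tends to the infimum, which is therefore
    realizable.\<close>
  have "\<exists>s\<in>R. s < lam0 + 1 / real (Suc k)" for k
    using cInf_lessD[of R "lam0 + 1 / real (Suc k)"] top by (auto simp: lam0_def)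
  then obtain s where s: "\<And>k. s k \<in> R" "\<And>k. s k < lam0 + 1 / real (Suc k)" by metis
  have "(\<lambda>k. lam0 + 1 / real (Suc k)) \<longlonglongrightarrow> lam0 + 0"
    by (intro tendsto_add tendsto_const LIMSEQ_Suc[OF lim_1_over_n])
  then have lim: "(\<lambda>k. lam0 + 1 / real (Suc k)) \<longlonglongrightarrow> lam0" by simp
  have ge: "lam0 \<le> s k" for k using cInf_lower[OF s(1) bdd] by (simp add: lam0_def)
  have "s \<longlonglongrightarrow> lam0"
    by (rule tendsto_sandwich[OF _ _ tendsto_const lim])
       (intro always_eventually allI ge less_imp_le s(2))+
  then have lam0: "realizable lam0 ?es"
    by (rule realizable_limit[rotated]) (use s(1) in \<open>simp add: R_def\<close>)
  have iff: "realizable r ?es \<longleftrightarrow> lam0 \<le> r" for r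
    using realizable_mono[OF lam0] cInf_lower[OF _ bdd, of r] by (auto simp: R_def lam0_def)
  have "Max ((\<lambda>j. cmod (lam j)) ` {2..n}) \<le> lam0"
    using p_ge p_le realizable_ge[OF lam0]
    by (auto simp: atLeastLessThanSuc_atLeastAtMost simp del: upt_Suc)
  moreover have "lam0 \<le> (real n - 1) * \<bar>w\<bar>" using top iff by (simp add: R_def)
  \<comment> \<open>Any competing \<open>t\<close> satisfying the equivalence is itself realizable,
    hence at least \<open>lam0\<close>.\<close>
  ultimately show ?thesis
    using iff by (intro exI[of _ lam0]) (auto simp: is_arg_min_def not_less)
qed

end
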